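(* Let $n\geq 1$. Then $$S_n(x)=F_{1,n}(x)P_n(x)+G_{1,n}(x)P_{n-1}(x),$$ where $$F_{1,n}(x)=1-\sum_{(j,k)\in I_+}\frac{\lambda_{j,k}\,k!\,S_n^{(k)}(c_j)}{\|P_{n-1}\|_\mu^2}\,\frac{Q_k(x,c_j;P_{n-1})}{(x-c_j)^{k+1}},\qquad G_{1,n}(x)=\sum_{(j,k)\in I_+}\frac{\lambda_{j,k}\,k!\,S_n^{(k)}(c_j)}{\|P_{n-1}\|_\mu^2}\,\frac{Q_k(x,c_j;P_n)}{(x-c_j)^{k+1}}.$$ Moreover, if $n\geq d$, then the matrix $\mathcal I_{d^*}+\mathcal K_{n-1}(\mathcal C,\mathcal C)\mathcal L$ is nonsingular and $$S_n(x)=P_n(x)-\mathcal K_{n-1}(x,\mathcal C)\,\mathcal L\,\bigl(\mathcal I_{d^*}+\mathcal K_{n-1}(\mathcal C,\mathcal C)\mathcal L\bigr)^{-1}\mathcal P_n(\mathcal C).$$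
   Context: Let $\mu$ be a finite positive Borel measure on $\mathbb R$ with finite moments whose support contains infinitely many points, and let $(a,b)$ be the interior of the convex hull of its support. Put $\langle f,g\rangle_\mu=\int fg\,d\mu$, $\|f\|_\mu^2=\langle f,f\rangle_\mu$, and let $\{P_n\}_{n\ge0}$ be the monic orthogonal polynomials for $\langle\cdot,\cdot\rangle_\mu$. Let $\mathbb Z_+$ be the nonnegative integers, $N,d_j\in\mathbb Z_+$, $\lambda_{j,k}\ge0$ for $1\le j\le N$, $0\le k\le d_j$, let $c_1,\dots,c_N\in\mathbb R\setminus(a,b)$ be distinct, and $I_+=\{(j,k):\lambda_{j,k}>0\}$. Assume $(j,d_j)\in I_+$ for every $j$ and $d_1\le\dots\le d_N$. Put $d=\sum_{j=1}^N(d_j+1)$ and $d^*=\#I_+$. Consider the Sobolev inner product $$\langle f,g\rangle_{\mathsf s}=\int f g\,d\mu+\sum_{(j,k)\in I_+}\lambda_{j,k}f^{(k)}(c_j)g^{(k)}(c_j),$$ and let $S_n$ be the monic polynomial of degree $n$ with $\langle x^i,S_n\rangle_{\mathsf s}=0$ for $0\le i\le n-1$. $Q_k(x,y;f)=\sum_{\nu=0}^k\frac{f^{(\nu)}(y)}{\nu!}(x-y)^\nu$ is the Taylor polynomial of degree $k$ of $f$ at $y$. The kernel is $K_{n-1}(x,y)=\sum_{i=0}^{n-1}P_i(x)P_i(y)/\|P_i\|_\mu^2$, and $K_{n-1}^{(\ell,k)}=\partial_x^\ell\partial_y^kK_{n-1}$. Fix an ordering of $I_+$. $\mathcal I_{d^*}$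 is the $d^*\times d^*$ identity matrix; $\mathcal L$ is the diagonal matrix with diagonal entries $\lambda_{j,k}$, $(j,k)\in I_+$; $\mathcal P_n(\mathcal C)$ is the column vector with entries $P_n^{(k)}(c_j)$, $(j,k)\in I_+$; $\mathcal K_{n-1}(x,\mathcal C)$ is the row vector with entries $K_{n-1}^{(0,k)}(x,c_j)$, $(j,k)\in I_+$; and $\mathcal K_{n-1}(\mathcal C,\mathcal C)$ is the $d^*\times d^*$ matrix whose entry in row $(i,\ell)$ and column $(j,k)$ is $K_{n-1}^{(\ell,k)}(c_i,c_j)$. *)

theory Defs
  imports
    "HOL-Analysis.Analysis"
    "HOL-Computational_Algebra.Polynomial"
    "Jordan_Normal_Form.Gauss_Jordan_Elimination"
begin

definition measure_support :: "real measure \<Rightarrow> real set" where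
  "measure_support M = {x. \<forall>U. open U \<and> x \<in> U \<longrightarrow> 0 < emeasure M U}"

abbreviation pderivn :: "nat \<Rightarrow> real poly \<Rightarrow> real poly" where
  "pderivn k f \<equiv> (pderiv ^^ k) f"

definition inner_mu :: "real measure \<Rightarrow> real poly \<Rightarrow> real poly \<Rightarrow> real" where
  "inner_mu M f g = (\<integral>x. poly f x * poly g x \<partial>M)"

definition norm_mu :: "real measure \<Rightarrow> real poly \<Rightarrow> real" where
  "norm_mu M f = sqrt (inner_mu M f f)"

definition I_plus :: "nat \<Rightarrow> (nat \<Rightarrow> nat) \<Rightarrow> (nat \<Rightarrow> nat \<Rightarrow> real) \<Rightarrow> (nat \<times> nat) set" where
  "I_plus N D lam = {(j, k). j \<in> {1..N} \<and> k \<le> D j \<and> lam j k > 0}"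

definition inner_sob ::
  "real measure \<Rightarrow> (nat \<times> nat) set \<Rightarrow> (nat \<Rightarrow> nat \<Rightarrow> real) \<Rightarrow> (nat \<Rightarrow> real)
    \<Rightarrow> real poly \<Rightarrow> real poly \<Rightarrow> real" where
  "inner_sob M I lam c f g =
     (\<integral>x. poly f x * poly g x \<partial>M)
     + (\<Sum>(j, k)\<in>I. lam j k * poly (pderivn k f) (c j) * poly (pderivn k g) (c j))"

definition monic_of_degree :: "nat \<Rightarrow> real poly \<Rightarrow> bool" where
  "monic_of_degree n p \<longleftrightarrow> degree p = n \<and> lead_coeff p = 1"

definition monic_orthogonal_polys :: "real measure \<Rightarrow> (nat \<Rightarrow> real poly) \<Rightarrow> bool" where
  "monic_orthogonal_polys M P \<longleftrightarrow>
     (\<forall>n. monic_of_degree n (P n)) \<and> (\<forall>m n. m \<noteq> n \<longrightarrow> inner_mu M (P m) (P n) = 0)"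

definition monic_sobolev_polys ::
  "real measure \<Rightarrow> (nat \<times> nat) set \<Rightarrow> (nat \<Rightarrow> nat \<Rightarrow> real) \<Rightarrow> (nat \<Rightarrow> real)
    \<Rightarrow> (nat \<Rightarrow> real poly) \<Rightarrow> bool" where
  "monic_sobolev_polys M I lam c S \<longleftrightarrow>
     (\<forall>n. monic_of_degree n (S n) \<and> (\<forall>i<n. inner_sob M I lam c (monom 1 i) (S n) = 0))"

definition taylor_poly :: "nat \<Rightarrow> real \<Rightarrow> real \<Rightarrow> real poly \<Rightarrow> real" where
  "taylor_poly k x y f = (\<Sum>\<nu>\<le>k. poly (pderivn \<nu> f) y / fact \<nu> * (x - y) ^ \<nu>)"

(* Index shift: kernel M P n is the kernel written K_{n-1}, the sum over i = 0, ..., n-1. *)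
definition kernel :: "real measure \<Rightarrow> (nat \<Rightarrow> real poly) \<Rightarrow> nat \<Rightarrow> real \<Rightarrow> real \<Rightarrow> real" where
  "kernel M P n x y = (\<Sum>i<n. poly (P i) x * poly (P i) y / (norm_mu M (P i))\<^sup>2)"

definition kernel_deriv ::
  "real measure \<Rightarrow> (nat \<Rightarrow> real poly) \<Rightarrow> nat \<Rightarrow> nat \<Rightarrow> nat \<Rightarrow> real \<Rightarrow> real \<Rightarrow> real" where
  "kernel_deriv M P n l k x y =
     (deriv ^^ l) (\<lambda>s. (deriv ^^ k) (\<lambda>t. kernel M P n s t) y) x"

(* F1 and G1 are rational functions, with possible poles only at the points c j; their values here
   are meaningful only for x different from every c j. *)
definition F1 ::
  "real measure \<Rightarrow> (nat \<times> nat) set \<Rightarrow> (nat \<Rightarrow> nat \<Rightarrow> real) \<Rightarrow> (nat \<Rightarrow> real)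
    \<Rightarrow> (nat \<Rightarrow> real poly) \<Rightarrow> (nat \<Rightarrow> real poly) \<Rightarrow> nat \<Rightarrow> real \<Rightarrow> real" where
  "F1 M I lam c P S n x =
     1 - (\<Sum>(j, k)\<in>I. lam j k * fact k * poly (pderivn k (S n)) (c j) / (norm_mu M (P (n - 1)))\<^sup>2
                    * (taylor_poly k x (c j) (P (n - 1)) / (x - c j) ^ (k + 1)))"

definition G1 ::
  "real measure \<Rightarrow> (nat \<times> nat) set \<Rightarrow> (nat \<Rightarrow> nat \<Rightarrow> real) \<Rightarrow> (nat \<Rightarrow> real)
    \<Rightarrow> (nat \<Rightarrow> real poly) \<Rightarrow> (nat \<Rightarrow> real poly) \<Rightarrow> nat \<Rightarrow> real \<Rightarrow> real" where
  "G1 M I lam c P S n x =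
     (\<Sum>(j, k)\<in>I. lam j k * fact k * poly (pderivn k (S n)) (c j) / (norm_mu M (P (n - 1)))\<^sup>2
                * (taylor_poly k x (c j) (P n) / (x - c j) ^ (k + 1)))"

(* In the following, e enumerates the index set I_plus by {0..<ds}, where ds is its cardinality,
   so (fst (e r), snd (e r)) is the r-th index pair (j, k). *)

definition L_mat :: "(nat \<Rightarrow> nat \<times> nat) \<Rightarrow> nat \<Rightarrow> (nat \<Rightarrow> nat \<Rightarrow> real) \<Rightarrow> real mat" where
  "L_mat e ds lam = mat_diag ds (\<lambda>r. lam (fst (e r)) (snd (e r)))"

definition P_vec ::
  "(nat \<Rightarrow> nat \<times> nat) \<Rightarrow> nat \<Rightarrow> (nat \<Rightarrow> real) \<Rightarrow> real poly \<Rightarrow> real Matrix.vec" where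
  "P_vec e ds c p = Matrix.vec ds (\<lambda>r. poly (pderivn (snd (e r)) p) (c (fst (e r))))"

definition K_row ::
  "(nat \<Rightarrow> nat \<times> nat) \<Rightarrow> nat \<Rightarrow> (nat \<Rightarrow> real) \<Rightarrow> real measure \<Rightarrow> (nat \<Rightarrow> real poly) \<Rightarrow> nat
    \<Rightarrow> real \<Rightarrow> real Matrix.vec" where
  "K_row e ds c M P n x =
     Matrix.vec ds (\<lambda>r. kernel_deriv M P n 0 (snd (e r)) x (c (fst (e r))))"

definition K_mat ::
  "(nat \<Rightarrow> nat \<times> nat) \<Rightarrow> nat \<Rightarrow> (nat \<Rightarrow> real) \<Rightarrow> real measure \<Rightarrow> (nat \<Rightarrow> real poly) \<Rightarrow> nat
    \<Rightarrow> real mat" where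
  "K_mat e ds c M P n =
     Matrix.mat ds ds (\<lambda>(r, s). kernel_deriv M P n (snd (e r)) (snd (e s))
                                  (c (fst (e r))) (c (fst (e s))))"

end

theory Submission
  imports Defs "Jordan_Normal_Form.Determinant"
begin

text \<open>
  Expanding \<open>S n\<close> in the basis \<open>P i\<close> and using its Sobolev orthogonality to \<open>P i\<close> for \<open>i < n\<close>
  expresses \<open>S n\<close> through the values \<open>S n ^ (k) (c j)\<close> and the derivatives of the kernel in its second
  variable. The Christoffel--Darboux formula, differentiated \<open>k\<close> times, turns this into the formula
  with \<open>F1\<close> and \<open>G1\<close>. Differentiating it in the first variable at the points \<open>c j\<close> instead gives a
  linear system for those values; its matrix is nonsingular because a Gram matrix is positive
  semidefinite.
\<close>

section \<open>Polynomials and real sums\<close>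

text \<open>Subtracting the right multiple of \<open>P n\<close> removes the top coefficient, which
  leaves the case of smaller \<open>n\<close>. Bounding the degree by vanishing coefficients makes
  \<open>n = 0\<close> mean \<open>p = 0\<close>.\<close>

lemma monic_basis_expansion:
  fixes P :: "nat \<Rightarrow> real poly"
  assumes "\<And>i. monic_of_degree i (P i)" and "\<And>i. i \<ge> n \<Longrightarrow> coeff p i = 0"
  shows "\<exists>a. p = (\<Sum>i<n. Polynomial.smult (a i) (P i))"
  using assms(2)
proof (induction n arbitrary: p)
  case 0
  then show ?case by (simp add: poly_eq_iff)
next
  case (Suc n)
  define q where "q = p - Polynomial.smult (coeff p n) (P n)"
  have "coeff q i = 0" if "i \<ge> n" for i
  proof (cases "i = n")
    case True
    then show ?thesis using assms(1)[of n] by (auto simp: q_def monic_of_degree_def)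
  next
    case False
    with that have "i > n" by simp
    moreover from this have "coeff (P n) i = 0"
      using assms(1)[of n] by (intro coeff_eq_0) (auto simp: monic_of_degree_def)
    ultimately show ?thesis using Suc.prems by (simp add: q_def)
  qed
  then obtain a where a: "q = (\<Sum>i<n. Polynomial.smult (a i) (P i))" using Suc.IH by blast
  have "p = q + Polynomial.smult (coeff p n) (P n)" by (simp add: q_def)
  also have "\<dots> = (\<Sum>i<Suc n. Polynomial.smult ((a(n := coeff p n)) i) (P i))"
    unfolding a by simp
  finally show ?case by blast
qed

section \<open>Iterated derivatives and Taylor polynomials\<close>

lemma funpow_deriv_poly: "(deriv ^^ k) (poly p) = poly ((pderiv ^^ k) p)" for p :: "real poly"
  by (induction k) (auto intro!: ext DERIV_imp_deriv)

lemma poly_higher_pderiv_sum_smult: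
  "poly (pderivn k (\<Sum>i\<in>A. Polynomial.smult (a i) (p i))) x = (\<Sum>i\<in>A. a i * poly (pderivn k (p i)) x)"
  by (simp add: higher_pderiv_sum higher_pderiv_smult poly_sum)

text \<open>Leibniz rule for the factor x - t in the variable t: its second derivative vanishes, so
  only two terms survive.\<close>

lemma higher_pderiv_linear_mult:
  fixes q :: "real poly"
  shows "poly (pderivn (Suc k) ([:x, -1:] * q)) y
    = (x - y) * poly (pderivn (Suc k) q) y - (real k + 1) * poly (pderivn k q) y"
proof -
  have "pderivn (Suc k) ([:x, -1:] * q)
      = [:x, -1:] * pderivn (Suc k) q - Polynomial.smult (real k + 1) (pderivn k q)"
  proof (induction k)
    case 0
    have "pderiv [:x, -1:] = -1" by (simp add: pderiv_pCons one_pCons)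
    then show ?case by (simp only: funpow_0 funpow.simps comp_apply id_apply pderiv_mult) simp
  next
    case (Suc k)
    have "pderivn (Suc (Suc k)) ([:x, -1:] * q)
        = pderiv ([:x, -1:] * pderivn (Suc k) q - Polynomial.smult (real k + 1) (pderivn k q))"
      using Suc by simp
    also have "\<dots> = [:x, -1:] * pderivn (Suc (Suc k)) q - pderivn (Suc k) q
        - Polynomial.smult (real k + 1) (pderivn (Suc k) q)"
      by (simp only: pderiv_diff pderiv_mult pderiv_smult) (simp add: pderiv_pCons)
    also have "\<dots> = [:x, -1:] * pderivn (Suc (Suc k)) q - Polynomial.smult (real (Suc k) + 1) (pderivn (Suc k) q)"
      by (simp add: smult_add_left numeral_poly)
    finally show ?case .
  qed
  then show ?thesis by (simp only: poly_diff poly_mult poly_smult) (simp add: algebra_simps)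
qed

text \<open>By the Leibniz rule the Taylor sum telescopes. Applied to the Christoffel-Darboux
  formula, this isolates a single derivative of the kernel.\<close>

lemma taylor_poly_linear_mult:
  "taylor_poly k x y ([:x, -1:] * q) = poly (pderivn k q) y / fact k * (x - y) ^ (k + 1)"
proof (induction k)
  case 0
  then show ?case by (simp add: taylor_poly_def algebra_simps)
next
  case (Suc k)
  have "taylor_poly (Suc k) x y ([:x, -1:] * q)
      = poly (pderivn k q) y / fact k * (x - y) ^ (k + 1)
        + poly (pderivn (Suc k) ([:x, -1:] * q)) y / fact (Suc k) * (x - y) ^ Suc k"
    using Suc by (simp add: taylor_poly_def)
  also have "\<dots> = poly (pderivn (Suc k) q) y / fact (Suc k) * (x - y) ^ (Suc k + 1)"
  proof -
    \<comment> \<open>With \<open>F\<close> = k! and \<open>K\<close> = k + 1, the multiples of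
      \<open>a\<close> cancel because (k + 1)! = \<open>K * F\<close>.\<close>
    have "a / F * z + (u * b - K * a) / (K * F) * z = b / (K * F) * (u * z)"
      if "F \<noteq> 0" "K \<noteq> 0" for a b F K u z :: real
      using that by (simp add: field_simps)
    from this[of "fact k" "real k + 1" "poly (pderivn k q) y" "(x - y) ^ Suc k" "x - y" "poly (pderivn (Suc k) q) y"] show ?thesis
      unfolding higher_pderiv_linear_mult fact_Suc of_nat_Suc
      by (simp only: add.commute[of 1] power_Suc power_add mult_ac) simp
  qed
  finally show ?case .
qed

lemma taylor_poly_diff: "taylor_poly k x y (f - g) = taylor_poly k x y f - taylor_poly k x y g"
proof -
  have "pderivn i (f - g) = pderivn i f - pderivn i g" for i
    using higher_pderiv_add[of i "f - g" g] by simp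
  then show ?thesis
    by (simp add: taylor_poly_def sum_subtractf left_diff_distrib diff_divide_distrib)
qed

lemma taylor_poly_smult: "taylor_poly k x y (Polynomial.smult a f) = a * taylor_poly k x y f"
  by (simp add: taylor_poly_def higher_pderiv_smult sum_distrib_left mult_ac)

text \<open>Write the system as (I + G L) v = 0 with G the weighted Gram matrix and L diagonal.
  Pairing it with L v gives v^T L v + (L v)^T G (L v) = 0. Both terms are nonnegative, so v^T L v =
  0, and positive weights force v = 0.\<close>

lemma identity_plus_gram_diag_injective:
  fixes l v :: "nat \<Rightarrow> real" and \<phi> :: "nat \<Rightarrow> nat \<Rightarrow> real"
  assumes "\<And>i. g i \<ge> 0" and l: "\<And>r. r < m \<Longrightarrow> l r > 0"
    and eq: "\<And>r. r < m \<Longrightarrow> v r + (\<Sum>s<m. (\<Sum>i<n. \<phi> i r * \<phi> i s * g i) * l s * v s) = 0"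
    and "r < m"
  shows "v r = 0"
proof -
  have "0 = (\<Sum>r<m. l r * v r * (v r + (\<Sum>s<m. (\<Sum>i<n. \<phi> i r * \<phi> i s * g i) * l s * v s)))"
    using eq by simp
  also have "\<dots> = (\<Sum>r<m. l r * (v r)\<^sup>2)
      + (\<Sum>r<m. \<Sum>s<m. \<Sum>i<n. g i * ((l r * v r * \<phi> i r) * (l s * v s * \<phi> i s)))"
    by (simp add: sum.distrib[symmetric] algebra_simps power2_eq_square sum_distrib_left
        sum_distrib_right)
  \<comment> \<open>With \<open>i\<close> outermost, the double sum over \<open>r\<close> and
    \<open>s\<close> becomes a perfect square.\<close>
  also have "(\<Sum>r<m. \<Sum>s<m. \<Sum>i<n. g i * ((l r * v r * \<phi> i r) * (l s * v s * \<phi> i s)))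
      = (\<Sum>r<m. \<Sum>i<n. \<Sum>s<m. g i * ((l r * v r * \<phi> i r) * (l s * v s * \<phi> i s)))"
    by (intro sum.cong refl sum.swap)
  also have "\<dots> = (\<Sum>i<n. \<Sum>r<m. \<Sum>s<m. g i * ((l r * v r * \<phi> i r) * (l s * v s * \<phi> i s)))"
    by (rule sum.swap)
  also have "\<dots> = (\<Sum>i<n. g i * (\<Sum>r<m. l r * v r * \<phi> i r)\<^sup>2)"
    by (simp only: power2_eq_square sum_product) (simp only: sum_distrib_left)
  finally have "(\<Sum>r<m. l r * (v r)\<^sup>2) \<le> 0"
    using sum_nonneg[of "{..<n}" "\<lambda>i. g i * (\<Sum>r<m. l r * v r * \<phi> i r)\<^sup>2"] assms(1) by simp
  moreover have nonneg: "\<forall>r\<in>{..<m}. l r * (v r)\<^sup>2 \<ge> 0" using l[THEN less_imp_le] by auto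
  ultimately have "(\<Sum>r<m. l r * (v r)\<^sup>2) = 0" by (meson order_antisym sum_nonneg)
  then have "l r * (v r)\<^sup>2 = 0"
    using nonneg \<open>r < m\<close> by (subst (asm) sum_nonneg_eq_0_iff) auto
  then show ?thesis using l[OF \<open>r < m\<close>] by simp
qed

section \<open>Orthogonal polynomials of a measure\<close>

locale moment_measure =
  fixes M :: "real measure"
  assumes sets_eq_borel: "sets M = sets borel"
    and integrable_power: "\<And>i::nat. integrable M (\<lambda>x. x ^ i)"
    and infinite_support: "infinite (measure_support M)"
begin

lemma integrable_poly: "integrable M (poly p)"
  unfolding poly_altdef by (intro Bochner_Integration.integrable_sum integrable_mult_right integrable_power)

lemma inner_mu_eq: "inner_mu M f g = (\<integral>x. poly (f * g) x \<partial>M)"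
  by (simp add: inner_mu_def)

lemma inner_mu_commute: "inner_mu M f g = inner_mu M g f"
  by (simp add: inner_mu_eq mult.commute)

lemma inner_mu_shift: "inner_mu M (f * g) h = inner_mu M f (g * h)"
  by (simp add: inner_mu_eq mult.assoc)

lemma inner_mu_sum_smult_left:
  "inner_mu M (\<Sum>i\<in>A. Polynomial.smult (a i) (p i)) q = (\<Sum>i\<in>A. a i * inner_mu M (p i) q)"
proof -
  have "inner_mu M (\<Sum>i\<in>A. Polynomial.smult (a i) (p i)) q = (\<integral>x. (\<Sum>i\<in>A. a i * poly (p i * q) x) \<partial>M)"
    by (simp add: inner_mu_def poly_sum sum_distrib_right mult.assoc)
  also have "\<dots> = (\<Sum>i\<in>A. \<integral>x. a i * poly (p i * q) x \<partial>M)"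
    by (intro Bochner_Integration.integral_sum integrable_mult_right integrable_poly)
  finally show ?thesis by (simp add: inner_mu_def)
qed

lemma inner_mu_diff_left: "inner_mu M (f - g) q = inner_mu M f q - inner_mu M g q"
  unfolding inner_mu_eq left_diff_distrib poly_diff
  by (rule Bochner_Integration.integral_diff[OF integrable_poly integrable_poly])

lemma inner_mu_self_nonneg: "inner_mu M p p \<ge> 0"
  by (simp add: inner_mu_def integral_nonneg_AE)

lemma norm_mu_square: "(norm_mu M p)\<^sup>2 = inner_mu M p p"
  by (simp add: norm_mu_def inner_mu_self_nonneg)

text \<open>If the integral of p^2 vanished, the open set where p is nonzero would be a null set and
  hence miss the support. The infinite support would then lie among the finitely many roots of
  p.\<close>

lemma inner_mu_self_pos:
  assumes "p \<noteq> 0"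
  shows "inner_mu M p p > 0"
proof (rule ccontr)
  assume "\<not> inner_mu M p p > 0"
  with inner_mu_self_nonneg[of p] have "(\<integral>x. poly (p * p) x \<partial>M) = 0"
    unfolding inner_mu_eq by (simp del: poly_mult)
  moreover have "AE x in M. 0 \<le> poly (p * p) x" by simp
  ultimately have "AE x in M. poly (p * p) x = 0"
    using integral_nonneg_eq_0_iff_AE[OF integrable_poly] by blast
  then have "AE x in M. poly p x = 0" by simp
  moreover have meas: "{x. poly p x \<noteq> 0} \<in> sets M"
    unfolding sets_eq_borel by (intro borel_open open_Collect_neq continuous_intros)
  ultimately have null: "emeasure M {x. poly p x \<noteq> 0} = 0"
    using AE_iff_measurable[OF meas] sets_eq_imp_space_eq[OF sets_eq_borel] by simp
  have "open {x. poly p x \<noteq> 0}" by (intro open_Collect_neq continuous_intros)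
  then have "measure_support M \<subseteq> {x. poly p x = 0}"
    using null unfolding measure_support_def by fastforce
  then show False
    using infinite_support poly_roots_finite[OF assms] finite_subset by blast
qed

end

section \<open>Expansions in monic orthogonal polynomials\<close>

locale orthogonal_polys = moment_measure +
  fixes P :: "nat \<Rightarrow> real poly"
  assumes orthogonal: "monic_orthogonal_polys M P"
begin

lemma monic_P: "monic_of_degree i (P i)"
  using orthogonal by (simp add: monic_orthogonal_polys_def)

lemma degree_P: "Polynomial.degree (P i) = i"
  using monic_P[of i] by (simp add: monic_of_degree_def)

lemma coeff_P_self: "coeff (P i) i = 1"
  using monic_P[of i] by (auto simp: monic_of_degree_def)

lemma inner_mu_P: "m \<noteq> n \<Longrightarrow> inner_mu M (P m) (P n) = 0"
  using orthogonal by (simp add: monic_orthogonal_polys_def)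

lemma inner_mu_P_self_pos: "inner_mu M (P i) (P i) > 0"
  using coeff_P_self[of i] by (intro inner_mu_self_pos) auto

lemma orthogonal_expansion:
  assumes "\<And>i. i \<ge> n \<Longrightarrow> coeff p i = 0"
  shows "p = (\<Sum>i<n. Polynomial.smult (inner_mu M p (P i) / inner_mu M (P i) (P i)) (P i))"
proof -
  obtain a where a: "p = (\<Sum>i<n. Polynomial.smult (a i) (P i))"
    using monic_basis_expansion[OF monic_P assms] by blast
  have "inner_mu M p (P i) = a i * inner_mu M (P i) (P i)" if "i < n" for i
  proof -
    have "inner_mu M p (P i) = (\<Sum>j<n. if j = i then a i * inner_mu M (P i) (P i) else 0)"
      unfolding a inner_mu_sum_smult_left by (intro sum.cong) (auto simp: inner_mu_P)
    then show ?thesis using that by simp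
  qed
  then have "a i = inner_mu M p (P i) / inner_mu M (P i) (P i)" if "i < n" for i
    using that inner_mu_P_self_pos[of i] by simp
  then have "(\<Sum>i<n. Polynomial.smult (a i) (P i))
      = (\<Sum>i<n. Polynomial.smult (inner_mu M p (P i) / inner_mu M (P i) (P i)) (P i))"
    by (intro sum.cong refl) auto
  \<comment> \<open>\<open>p\<close> also occurs in the coefficients on the right, so transitivity
    is used instead of rewriting with \<open>a\<close>.\<close>
  then show ?thesis using a by (rule trans[rotated])
qed

lemma inner_mu_P_lower_degree:
  assumes "\<And>i. i \<ge> n \<Longrightarrow> coeff p i = 0"
  shows "inner_mu M p (P n) = 0"
  by (subst orthogonal_expansion[OF assms])
    (auto simp: inner_mu_sum_smult_left inner_mu_P intro!: sum.neutral)

text \<open>Two monic polynomials of degree n differ by one of lower degree, which is orthogonal to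
  \<open>P n\<close>.\<close>

lemma inner_mu_monic:
  assumes "monic_of_degree n p"
  shows "inner_mu M p (P n) = inner_mu M (P n) (P n)"
proof -
  have "coeff (p - P n) i = 0" if "i \<ge> n" for i
    using that assms coeff_P_self[of n] degree_P[of n]
    by (cases "i = n") (auto simp: monic_of_degree_def coeff_eq_0)
  then have "inner_mu M (p - P n) (P n) = 0" by (rule inner_mu_P_lower_degree)
  then show ?thesis by (simp add: inner_mu_diff_left)
qed

text \<open>Multiplication by the variable is self-adjoint. Hence x P_{m+1} - P_{m+2}, of degree at
  most m + 1, pairs with P_i for i <= m as x P_i does with P_{m+1}: this is 0 for i < m, and the
  squared norm of P_{m+1} for i = m. The value of \<open>b\<close> stays open because it cancels in
  the Christoffel-Darboux formula.\<close>

lemma three_term_recurrence: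
  "\<exists>b. P (Suc (Suc m)) = [:-b, 1:] * P (Suc m)
    - Polynomial.smult (inner_mu M (P (Suc m)) (P (Suc m)) / inner_mu M (P m) (P m)) (P m)"
proof -
  let ?X = "[:0, 1:] :: real poly"
  define p where "p = ?X * P (Suc m) - P (Suc (Suc m))"
  define a where "a i = inner_mu M p (P i) / inner_mu M (P i) (P i)" for i
  have "coeff p i = 0" if "i \<ge> Suc (Suc m)" for i
    using that coeff_P_self degree_P
    by (cases "i = Suc (Suc m)") (auto simp: p_def coeff_pCons coeff_eq_0 split: nat.split)
  then have "p = (\<Sum>i<Suc (Suc m). Polynomial.smult (a i) (P i))"
    unfolding a_def by (rule orthogonal_expansion)
  moreover have inner: "inner_mu M p (P i) = inner_mu M (?X * P i) (P (Suc m))" if "i \<le> m" for i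
  proof -
    have "inner_mu M (?X * P (Suc m)) (P i) = inner_mu M (?X * P i) (P (Suc m))"
      by (metis inner_mu_shift inner_mu_commute mult.commute)
    then show ?thesis
      using that inner_mu_P[of "Suc (Suc m)" i] by (simp only: p_def inner_mu_diff_left)
  qed
  have "a i = 0" if "i < m" for i
  proof -
    have "inner_mu M (?X * P i) (P (Suc m)) = 0"
      using that degree_P[of i]
      by (intro inner_mu_P_lower_degree) (auto simp: coeff_pCons coeff_eq_0 split: nat.split)
    then show ?thesis using inner that by (simp add: a_def)
  qed
  moreover have "a m = inner_mu M (P (Suc m)) (P (Suc m)) / inner_mu M (P m) (P m)"
  proof -
    have "monic_of_degree (Suc m) (?X * P m)"
      using monic_P[of m] by (auto simp: monic_of_degree_def degree_mult_eq)
    then show ?thesis using inner[of m] by (simp add: a_def inner_mu_monic)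
  qed
  ultimately have "p = Polynomial.smult (inner_mu M (P (Suc m)) (P (Suc m)) / inner_mu M (P m) (P m)) (P m)
      + Polynomial.smult (a (Suc m)) (P (Suc m))"
    by simp
  then have "P (Suc (Suc m)) = [:- a (Suc m), 1:] * P (Suc m)
      - Polynomial.smult (inner_mu M (P (Suc m)) (P (Suc m)) / inner_mu M (P m) (P m)) (P m)"
    by (simp add: p_def algebra_simps)
  then show ?thesis by blast
qed

text \<open>Inserting the three-term recurrence on the right cancels \<open>b\<close>; the terms in
  P_m reproduce the previous right-hand side and the rest is the new summand of the kernel. The
  multiplied-out form also covers x = y, so it is an identity of polynomials in y.\<close>

lemma Christoffel_Darboux:
  "(x - y) * kernel M P (Suc m) x y
    = (poly (P (Suc m)) x * poly (P m) y - poly (P (Suc m)) y * poly (P m) x)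
      / inner_mu M (P m) (P m)"
proof (induction m)
  case 0
  have 0: "P 0 = 1"
    using degree_P[of 0] coeff_P_self[of 0] by (metis degree_eq_zeroE coeff_pCons_0 one_pCons)
  obtain a b where ab: "P (Suc 0) = [:a, b:]"
    using degree_P[of "Suc 0"] degree1_coeffs by (metis One_nat_def)
  then show ?case
    using 0 coeff_P_self[of "Suc 0"] by (simp add: kernel_def norm_mu_square)
next
  case (Suc m)
  let ?h = "\<lambda>i. inner_mu M (P i) (P i)"
  obtain b where b: "P (Suc (Suc m)) = [:-b, 1:] * P (Suc m) - Polynomial.smult (?h (Suc m) / ?h m) (P m)"
    using three_term_recurrence by blast
  have pos: "?h m \<noteq> 0" "?h (Suc m) \<noteq> 0" using inner_mu_P_self_pos by (metis less_irrefl)+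
  have kernel_Suc: "(x - y) * kernel M P (Suc (Suc m)) x y
      = (x - y) * kernel M P (Suc m) x y
        + (x - y) * (poly (P (Suc m)) x * poly (P (Suc m)) y / ?h (Suc m))"
    by (simp add: kernel_def norm_mu_square algebra_simps)
  show ?case
    unfolding kernel_Suc Suc.IH b using pos by (simp add: field_simps)
qed

text \<open>This is K_{n-1}^{(0,k)}(., y) as a polynomial in the first variable, so that
  \<open>deriv\<close> can be computed by \<open>pderiv\<close>.\<close>

definition kernel_poly :: "nat \<Rightarrow> nat \<Rightarrow> real \<Rightarrow> real poly" where
  "kernel_poly n k y
    = (\<Sum>i<n. Polynomial.smult (poly (pderivn k (P i)) y / inner_mu M (P i) (P i)) (P i))"

text \<open>By symmetry of the kernel the same polynomial describes its dependence on the second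
  variable when the first is fixed at \<open>x\<close>.\<close>

lemma kernel_eq: "kernel M P n x = poly (kernel_poly n 0 x)"
  by (auto simp: kernel_def kernel_poly_def poly_sum norm_mu_square mult_ac)

lemma kernel_deriv_eq:
  "kernel_deriv M P n l k x y
    = (\<Sum>i<n. poly (pderivn l (P i)) x * poly (pderivn k (P i)) y / inner_mu M (P i) (P i))"
proof -
  have "(\<lambda>s. (deriv ^^ k) (\<lambda>t. kernel M P n s t) y) = poly (kernel_poly n k y)"
    unfolding kernel_eq funpow_deriv_poly
    by (simp add: kernel_poly_def poly_higher_pderiv_sum_smult fun_eq_iff poly_sum mult_ac)
  then show ?thesis
    unfolding kernel_deriv_def
    by (simp add: funpow_deriv_poly kernel_poly_def poly_higher_pderiv_sum_smult mult_ac)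
qed

lemma kernel_deriv_Christoffel_Darboux:
  assumes "x \<noteq> y" and "n \<ge> 1"
  shows "kernel_deriv M P n 0 k x y = fact k / inner_mu M (P (n - 1)) (P (n - 1)) *
    (taylor_poly k x y (P (n - 1)) / (x - y) ^ (k + 1) * poly (P n) x
      - taylor_poly k x y (P n) / (x - y) ^ (k + 1) * poly (P (n - 1)) x)"
proof -
  obtain m where m: "n = Suc m" using \<open>n \<ge> 1\<close> by (cases n) auto
  let ?h = "inner_mu M (P m) (P m)"
  have pos: "?h \<noteq> 0" using inner_mu_P_self_pos[of m] by simp
  have "poly (Polynomial.smult ?h ([:x, -1:] * kernel_poly n 0 x)) y
      = poly (Polynomial.smult (poly (P n) x) (P m) - Polynomial.smult (poly (P m) x) (P n)) y" for y
    using Christoffel_Darboux[of x y m] pos unfolding kernel_eq m by (simp add: field_simps)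
  then have "Polynomial.smult ?h ([:x, -1:] * kernel_poly n 0 x)
      = Polynomial.smult (poly (P n) x) (P m) - Polynomial.smult (poly (P m) x) (P n)"
    unfolding poly_eq_poly_eq_iff[symmetric] by (intro ext)
  \<comment> \<open>Both sides are polynomials in the second variable. Expanding them at
    \<open>y\<close> and evaluating at \<open>x\<close> telescopes the left side to one kernel
    derivative times a power of x - y.\<close>
  from arg_cong[OF this, of "taylor_poly k x y"]
  have "?h * (poly (pderivn k (kernel_poly n 0 x)) y / fact k * (x - y) ^ (k + 1))
      = poly (P n) x * taylor_poly k x y (P m) - poly (P m) x * taylor_poly k x y (P n)"
    unfolding taylor_poly_diff taylor_poly_linear_mult taylor_poly_smult .
  moreover have "poly (pderivn k (kernel_poly n 0 x)) y = kernel_deriv M P n 0 k x y"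
    by (simp add: kernel_poly_def kernel_deriv_eq poly_higher_pderiv_sum_smult)
  moreover have "(x - y) ^ (k + 1) \<noteq> 0" using \<open>x \<noteq> y\<close> by simp
  ultimately show ?thesis
    using pos unfolding m by (simp add: field_simps del: power_Suc)
qed

section \<open>Sobolev orthogonal polynomials\<close>

text \<open>The difference S_n - P_n has degree below n and is expanded in the P_i. Sobolev
  orthogonality trades each coefficient for the discrete part of the inner product, and exchanging
  the sums assembles kernel derivatives. Order l = 0 yields formulas for S_n itself; general l at
  the points c_j yields a linear system.\<close>

lemma sobolev_kernel_expansion:
  assumes S: "monic_sobolev_polys M I lam c S"
  shows "poly (pderivn l (S n)) x = poly (pderivn l (P n)) x
    - (\<Sum>(j, k)\<in>I. kernel_deriv M P n l k x (c j) * lam j k * poly (pderivn k (S n)) (c j))"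
proof -
  let ?h = "\<lambda>i. inner_mu M (P i) (P i)"
  have monic: "monic_of_degree n (S n)"
    and orth: "\<And>i. i < n \<Longrightarrow> inner_sob M I lam c (monom 1 i) (S n) = 0"
    using S by (auto simp: monic_sobolev_polys_def)
  have "coeff (S n - P n) i = 0" if "i \<ge> n" for i
    using that monic coeff_P_self[of n] degree_P[of n]
    by (cases "i = n") (auto simp: monic_of_degree_def coeff_eq_0)
  then have "S n - P n = (\<Sum>i<n. Polynomial.smult (inner_mu M (S n - P n) (P i) / ?h i) (P i))"
    by (rule orthogonal_expansion)
  \<comment> \<open>For i < n the polynomial \<open>P n\<close> is orthogonal to \<open>P i\<close>
    and drops out.\<close>
  also have "\<dots> = (\<Sum>i<n. Polynomial.smult (inner_mu M (P i) (S n) / ?h i) (P i))"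
    by (intro sum.cong) (auto simp: inner_mu_diff_left inner_mu_P inner_mu_commute[of "S n"])
  also have "\<dots> = (\<Sum>i<n. Polynomial.smult (- (\<Sum>(j, k)\<in>I. lam j k * poly (pderivn k (P i)) (c j)
      * poly (pderivn k (S n)) (c j)) / ?h i) (P i))"
  proof (intro sum.cong refl)
    fix i assume "i \<in> {..<n}"
    then have i: "i < n" by simp
    \<comment> \<open>Sobolev orthogonality is given for monomials; by linearity it passes to
      \<open>P i\<close>.\<close>
    have P_i: "P i = (\<Sum>m\<le>i. Polynomial.smult (coeff (P i) m) (monom 1 m))"
      using poly_as_sum_of_monoms[of "P i"] by (simp add: degree_P smult_monom)
    let ?J = "\<lambda>p. \<Sum>(j, k)\<in>I. lam j k * poly (pderivn k p) (c j) * poly (pderivn k (S n)) (c j)"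
    have "?J (P i) = (\<Sum>m\<le>i. coeff (P i) m * ?J (monom 1 m))"
    proof -
      have "?J (P i) = (\<Sum>(j, k)\<in>I. \<Sum>m\<le>i. coeff (P i) m *
          (lam j k * poly (pderivn k (monom 1 m)) (c j) * poly (pderivn k (S n)) (c j)))"
        by (subst P_i, unfold poly_higher_pderiv_sum_smult)
          (simp add: sum_distrib_left sum_distrib_right mult_ac)
      also have "\<dots> = (\<Sum>m\<le>i. \<Sum>(j, k)\<in>I. coeff (P i) m *
          (lam j k * poly (pderivn k (monom 1 m)) (c j) * poly (pderivn k (S n)) (c j)))"
        unfolding case_prod_unfold by (rule sum.swap)
      finally show ?thesis by (simp add: sum_distrib_left case_prod_unfold)
    qed
    moreover have "inner_mu M (P i) (S n) = (\<Sum>m\<le>i. coeff (P i) m * inner_mu M (monom 1 m) (S n))"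
      by (subst P_i, unfold inner_mu_sum_smult_left) simp
    moreover have "inner_mu M (monom 1 m) (S n) = - ?J (monom 1 m)" if "m \<le> i" for m
      using orth[of m] that i by (simp add: inner_sob_def inner_mu_def)
    ultimately have "inner_mu M (P i) (S n) = - ?J (P i)"
      by (simp add: sum_negf)
    then show "Polynomial.smult (inner_mu M (P i) (S n) / ?h i) (P i) = Polynomial.smult (- ?J (P i) / ?h i) (P i)"
      by simp
  qed
  finally have "S n = P n + \<dots>" by (simp add: algebra_simps)
  from arg_cong[OF this, of "\<lambda>p. poly (pderivn l p) x"]
  have "poly (pderivn l (S n)) x = poly (pderivn l (P n)) x
      + (\<Sum>i<n. - (\<Sum>(j, k)\<in>I. lam j k * poly (pderivn k (P i)) (c j)
      * poly (pderivn k (S n)) (c j)) / ?h i * poly (pderivn l (P i)) x)"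
    unfolding higher_pderiv_add poly_add poly_higher_pderiv_sum_smult .
  also have "(\<Sum>i<n. - (\<Sum>(j, k)\<in>I. lam j k * poly (pderivn k (P i)) (c j)
      * poly (pderivn k (S n)) (c j)) / ?h i * poly (pderivn l (P i)) x)
    = - (\<Sum>i<n. \<Sum>(j, k)\<in>I. poly (pderivn l (P i)) x * poly (pderivn k (P i)) (c j) / ?h i
        * lam j k * poly (pderivn k (S n)) (c j))"
    by (simp add: sum_negf sum_distrib_left sum_distrib_right sum_divide_distrib case_prod_unfold
        mult_ac)
  also have "(\<Sum>i<n. \<Sum>(j, k)\<in>I. poly (pderivn l (P i)) x * poly (pderivn k (P i)) (c j) / ?h i
        * lam j k * poly (pderivn k (S n)) (c j))
    = (\<Sum>(j, k)\<in>I. \<Sum>i<n. poly (pderivn l (P i)) x * poly (pderivn k (P i)) (c j) / ?h i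
        * lam j k * poly (pderivn k (S n)) (c j))"
    unfolding case_prod_unfold by (rule sum.swap)
  also have "\<dots> = (\<Sum>(j, k)\<in>I. kernel_deriv M P n l k x (c j) * lam j k
      * poly (pderivn k (S n)) (c j))"
    by (simp add: kernel_deriv_eq sum_distrib_right case_prod_unfold)
  finally show ?thesis by simp
qed

text \<open>Replace each kernel derivative in the expansion of order l = 0 by its
  Christoffel-Darboux form and collect the multiples of P_n and P_{n-1}.\<close>

lemma sobolev_F1_G1:
  assumes S: "monic_sobolev_polys M I lam c S" and "n \<ge> 1"
    and x: "\<And>j k. (j, k) \<in> I \<Longrightarrow> x \<noteq> c j"
  shows "poly (S n) x = F1 M I lam c P S n x * poly (P n) x
    + G1 M I lam c P S n x * poly (P (n - 1)) x"
proof -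
  let ?h = "inner_mu M (P (n - 1)) (P (n - 1))"
  let ?a = "\<lambda>j k. lam j k * fact k * poly (pderivn k (S n)) (c j) / ?h"
  let ?Q = "\<lambda>j k m. taylor_poly k x (c j) (P m) / (x - c j) ^ (k + 1)"
  have "poly (S n) x = poly (P n) x
      - (\<Sum>(j, k)\<in>I. kernel_deriv M P n 0 k x (c j) * lam j k * poly (pderivn k (S n)) (c j))"
    using sobolev_kernel_expansion[OF S, of 0 n x] by simp
  also have "(\<Sum>(j, k)\<in>I. kernel_deriv M P n 0 k x (c j) * lam j k * poly (pderivn k (S n)) (c j))
      = (\<Sum>(j, k)\<in>I. ?a j k * ?Q j k (n - 1) * poly (P n) x - ?a j k * ?Q j k n * poly (P (n - 1)) x)"
  proof (intro sum.cong refl, clarify)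
    fix j k assume "(j, k) \<in> I"
    then show "kernel_deriv M P n 0 k x (c j) * lam j k * poly (pderivn k (S n)) (c j)
        = ?a j k * ?Q j k (n - 1) * poly (P n) x - ?a j k * ?Q j k n * poly (P (n - 1)) x"
      unfolding kernel_deriv_Christoffel_Darboux[OF x[OF \<open>(j, k) \<in> I\<close>] \<open>n \<ge> 1\<close>]
      by (simp add: algebra_simps)
  qed
  also have "\<dots> = (\<Sum>(j, k)\<in>I. ?a j k * ?Q j k (n - 1)) * poly (P n) x
      - (\<Sum>(j, k)\<in>I. ?a j k * ?Q j k n) * poly (P (n - 1)) x"
    by (simp add: case_prod_unfold sum_subtractf sum_distrib_right)
  finally show ?thesis
    unfolding F1_def G1_def norm_mu_square by (simp add: algebra_simps)
qed

section \<open>Nonsingularity and the matrix formula\<close>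

lemma invertible_identity_plus_kernel:
  fixes n ds :: nat and c :: "nat \<Rightarrow> real" and e :: "nat \<Rightarrow> nat \<times> nat" and lam :: "nat \<Rightarrow> nat \<Rightarrow> real"
  assumes lam: "\<And>r. r < ds \<Longrightarrow> lam (fst (e r)) (snd (e r)) > 0"
  defines "A \<equiv> 1\<^sub>m ds + K_mat e ds c M P n * L_mat e ds lam"
  shows "\<exists>B. mat_inverse A = Some B"
proof -
  let ?l = "\<lambda>r. lam (fst (e r)) (snd (e r))"
  let ?\<phi> = "\<lambda>i r. poly (pderivn (snd (e r)) (P i)) (c (fst (e r)))"
  have K: "K_mat e ds c M P n \<in> carrier_mat ds ds" by (simp add: K_mat_def)
  have A: "A \<in> carrier_mat ds ds" unfolding A_def L_mat_def using K by auto
  have "det A \<noteq> 0"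
  proof
    assume "det A = 0"
    then obtain v where v: "v \<in> carrier_vec ds" "v \<noteq> 0\<^sub>v ds" "A *\<^sub>v v = 0\<^sub>v ds"
      using det_0_iff_vec_prod_zero[OF A] by blast
    \<comment> \<open>\<open>K_mat\<close> is a Gram matrix with weights 1/||P_i||^2 and
      \<open>L_mat\<close> is a positive diagonal matrix, so a null vector of \<open>A\<close> must
      vanish.\<close>
    have "vec_index v r = 0" if "r < ds" for r
    proof (rule identity_plus_gram_diag_injective[where m = ds and l = ?l and n = n and \<phi> = ?\<phi>
          and g = "\<lambda>i. 1 / inner_mu M (P i) (P i)" and v = "vec_index v"])
      fix r assume r: "r < ds"
      have entry: "vec_index (row A r) s = (if r = s then 1 else 0)
          + (\<Sum>i<n. ?\<phi> i r * ?\<phi> i s * (1 / inner_mu M (P i) (P i))) * ?l s" if "s < ds" for s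
      proof -
        have "vec_index (row A r) s = A $$ (r, s)" using A r that by simp
        then show ?thesis
          using r that unfolding A_def L_mat_def mat_diag_mult_right[OF K]
          by (simp add: K_mat_def kernel_deriv_eq)
      qed
      have "0 = vec_index (A *\<^sub>v v) r" using v r by simp
      also have "\<dots> = (\<Sum>s<ds. vec_index (row A r) s * vec_index v s)"
        using r v(1) A by (simp add: scalar_prod_def atLeast0LessThan)
      also have "\<dots> = (\<Sum>s<ds. (if r = s then vec_index v s else 0)
          + (\<Sum>i<n. ?\<phi> i r * ?\<phi> i s * (1 / inner_mu M (P i) (P i))) * ?l s * vec_index v s)"
        by (intro sum.cong refl) (simp add: entry algebra_simps)
      also have "\<dots> = vec_index v r
          + (\<Sum>s<ds. (\<Sum>i<n. ?\<phi> i r * ?\<phi> i s * (1 / inner_mu M (P i) (P i))) * ?l s * vec_index v s)"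
        using r by (simp add: sum.distrib)
      finally show "vec_index v r
          + (\<Sum>s<ds. (\<Sum>i<n. ?\<phi> i r * ?\<phi> i s * (1 / inner_mu M (P i) (P i))) * ?l s * vec_index v s)
          = 0" by simp
    qed (use lam that inner_mu_self_nonneg in auto)
    then have "v = 0\<^sub>v ds" using v(1) by (intro eq_vecI) auto
    then show False using v(2) by simp
  qed
  \<comment> \<open>For a unit of the matrix ring, \<open>mat_inverse\<close> cannot return
    \<open>None\<close>.\<close>
  then have "A \<in> Units (ring_mat TYPE(real) ds ())"
    by (rule det_non_zero_imp_unit[OF A])
  then show ?thesis using mat_inverse(1)[OF A, where b = "()"] by (cases "mat_inverse A") auto
qed

text \<open>Let s collect the values S_n^{(k)}(c_j). The kernel expansion at the points c_j says
  that A s is the vector of the P_n^{(k)}(c_j); solving for s and inserting it into the expansion of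
  order 0 gives the formula.\<close>

lemma sobolev_matrix_formula:
  fixes n ds :: nat and c :: "nat \<Rightarrow> real" and e :: "nat \<Rightarrow> nat \<times> nat" and lam :: "nat \<Rightarrow> nat \<Rightarrow> real"
  assumes S: "monic_sobolev_polys M I lam c S" and e: "bij_betw e {0..<ds} I"
  defines "A \<equiv> 1\<^sub>m ds + K_mat e ds c M P n * L_mat e ds lam"
  assumes B: "mat_inverse A = Some B"
  shows "poly (S n) x = poly (P n) x
    - scalar_prod (K_row e ds c M P n x) ((L_mat e ds lam * B) *\<^sub>v P_vec e ds c (P n))"
proof -
  let ?l = "\<lambda>r. lam (fst (e r)) (snd (e r))"
  let ?s = "\<lambda>r. poly (pderivn (snd (e r)) (S n)) (c (fst (e r)))"
  define s where "s = P_vec e ds c (S n)"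
  define w where "w = L_mat e ds lam *\<^sub>v s"
  have s: "s \<in> carrier_vec ds" by (simp add: s_def P_vec_def)
  have K: "K_mat e ds c M P n \<in> carrier_mat ds ds" by (simp add: K_mat_def)
  have L: "L_mat e ds lam \<in> carrier_mat ds ds" by (simp add: L_mat_def)
  have A: "A \<in> carrier_mat ds ds" unfolding A_def using K L by auto
  have BA: "B * A = 1\<^sub>m ds" and B_carrier: "B \<in> carrier_mat ds ds"
    using mat_inverse(2)[OF A B] by auto
  have reindex: "(\<Sum>(j, k)\<in>I. f j k) = (\<Sum>r<ds. f (fst (e r)) (snd (e r)))" for f :: "nat \<Rightarrow> nat \<Rightarrow> real"
    using sum.reindex_bij_betw[OF e, of "\<lambda>(j, k). f j k"]
    by (simp add: case_prod_unfold atLeast0LessThan)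
  have Ls: "vec_index w r = ?l r * ?s r" if "r < ds" for r
  proof -
    have "vec_index w r = (\<Sum>i<ds. if r = i then ?l i * ?s i else 0)"
      using that s
      by (simp add: w_def L_mat_def mat_diag_def scalar_prod_def s_def P_vec_def atLeast0LessThan
          if_distrib[of "\<lambda>x. x * _"] cong: if_cong)
    then show ?thesis using that by simp
  qed
  have Ls_carrier: "w \<in> carrier_vec ds" using L s by (simp add: w_def)
  have "A *\<^sub>v s = P_vec e ds c (P n)"
  proof (rule eq_vecI)
    fix r assume "r < dim_vec (P_vec e ds c (P n))"
    then have r: "r < ds" by (simp add: P_vec_def)
    have "A *\<^sub>v s = s + K_mat e ds c M P n *\<^sub>v w"
      unfolding A_def w_def using K L s
      by (simp add: add_mult_distrib_mat_vec[of _ ds ds] assoc_mult_mat_vec[of _ ds ds _ ds])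
    moreover have "vec_index (K_mat e ds c M P n *\<^sub>v w) r
        = (\<Sum>q<ds. kernel_deriv M P n (snd (e r)) (snd (e q)) (c (fst (e r))) (c (fst (e q)))
            * ?l q * ?s q)"
      using r Ls Ls_carrier
      by (simp add: scalar_prod_def K_mat_def atLeast0LessThan mult.assoc)
    ultimately show "vec_index (A *\<^sub>v s) r = vec_index (P_vec e ds c (P n)) r"
      using r sobolev_kernel_expansion[OF S, of "snd (e r)" n "c (fst (e r))"] K L s
      by (simp add: reindex s_def P_vec_def)
  qed (use A in \<open>simp add: P_vec_def\<close>)
  then have "B *\<^sub>v P_vec e ds c (P n) = (B * A) *\<^sub>v s"
    using A B_carrier s by (simp add: assoc_mult_mat_vec[of _ ds ds _ ds])
  then have "B *\<^sub>v P_vec e ds c (P n) = s" using BA s by simp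
  then have "(L_mat e ds lam * B) *\<^sub>v P_vec e ds c (P n) = w"
    unfolding w_def using L B_carrier by (simp add: assoc_mult_mat_vec[of _ ds ds _ ds] P_vec_def)
  moreover have "scalar_prod (K_row e ds c M P n x) w
      = (\<Sum>q<ds. kernel_deriv M P n 0 (snd (e q)) x (c (fst (e q))) * ?l q * ?s q)"
    using Ls Ls_carrier
    by (simp add: scalar_prod_def K_row_def atLeast0LessThan mult.assoc)
  ultimately show ?thesis
    using sobolev_kernel_expansion[OF S, of 0 n x] by (simp add: reindex)
qed

end

theorem mainTheorem1:
  fixes M :: "real measure"
    and N n :: nat
    and D :: "nat \<Rightarrow> nat"
    and lam :: "nat \<Rightarrow> nat \<Rightarrow> real"
    and c :: "nat \<Rightarrow> real"
    and P S :: "nat \<Rightarrow> real poly"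
    and e :: "nat \<Rightarrow> nat \<times> nat"
  defines "I \<equiv> I_plus N D lam"
    and "ds \<equiv> card (I_plus N D lam)"
    and "A \<equiv> 1\<^sub>m (card (I_plus N D lam))
              + K_mat e (card (I_plus N D lam)) c M P n * L_mat e (card (I_plus N D lam)) lam"
  assumes "sets M = sets borel"
    and "finite_measure M"
    and "\<And>i::nat. integrable M (\<lambda>x. x ^ i)"
    and "infinite (measure_support M)"
    and "monic_orthogonal_polys M P"
    and "\<And>j k. j \<in> {1..N} \<Longrightarrow> k \<le> D j \<Longrightarrow> lam j k \<ge> 0"
    and "\<And>j. j \<in> {1..N} \<Longrightarrow> c j \<notin> interior (convex hull (measure_support M))"
    and "inj_on c {1..N}"
    and "\<And>j. j \<in> {1..N} \<Longrightarrow> (j, D j) \<in> I"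
    and "\<And>i j. 1 \<le> i \<Longrightarrow> i \<le> j \<Longrightarrow> j \<le> N \<Longrightarrow> D i \<le> D j"
    and "monic_sobolev_polys M I lam c S"
    and "bij_betw e {0..<ds} I"
    and "n \<ge> 1"
  shows "(\<forall>x. x \<notin> c ` {1..N} \<longrightarrow>
            poly (S n) x = F1 M I lam c P S n x * poly (P n) x
                           + G1 M I lam c P S n x * poly (P (n - 1)) x)
       \<and> (n \<ge> (\<Sum>j=1..N. D j + 1) \<longrightarrow>
            invertible_mat A \<and>
            (\<forall>x. poly (S n) x = poly (P n) x
                 - scalar_prod (K_row e ds c M P n x)
                     ((L_mat e ds lam * the (mat_inverse A)) *\<^sub>v P_vec e ds c (P n))))"
proof -
  interpret orthogonal_polys M P
    using assms by unfold_locales auto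
  have pos: "lam (fst (e r)) (snd (e r)) > 0" if "r < ds" for r
  proof -
    have "e r \<in> I" using bij_betwE[OF \<open>bij_betw e {0..<ds} I\<close>] that by simp
    then show ?thesis by (auto simp: I_def I_plus_def)
  qed
  \<comment> \<open>This makes \<open>the (mat_inverse A)\<close> in the claim a genuine
    inverse.\<close>
  obtain B where B: "mat_inverse A = Some B"
    using invertible_identity_plus_kernel[of ds lam e c n, OF pos]
    unfolding A_def ds_def by blast
  have A: "A \<in> carrier_mat ds ds"
    unfolding A_def ds_def L_mat_def
    by (intro add_carrier_mat mult_carrier_mat[OF _ mat_diag_dim]) (simp add: K_mat_def)
  have "invertible_mat A"
    using mat_inverse(2)[OF A B] A unfolding invertible_mat_def inverts_mat_def by auto
  moreover have "poly (S n) x = poly (P n) x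
      - scalar_prod (K_row e ds c M P n x)
          ((L_mat e ds lam * the (mat_inverse A)) *\<^sub>v P_vec e ds c (P n))" for x
    using sobolev_matrix_formula[OF \<open>monic_sobolev_polys M I lam c S\<close> \<open>bij_betw e {0..<ds} I\<close>] B
    unfolding A_def ds_def by simp
  \<comment> \<open>First components of \<open>I\<close> lie in \<open>{1..N}\<close>, so such an
    \<open>x\<close> avoids every pole of \<open>F1\<close> and \<open>G1\<close>.\<close>
  moreover have "poly (S n) x = F1 M I lam c P S n x * poly (P n) x
      + G1 M I lam c P S n x * poly (P (n - 1)) x" if "x \<notin> c ` {1..N}" for x
    using that
    by (intro sobolev_F1_G1[OF \<open>monic_sobolev_polys M I lam c S\<close> \<open>n \<ge> 1\<close>])
      (auto simp: I_def I_plus_def)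
  ultimately show ?thesis by blast
qed

end
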